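(* Let $a,b\in\mathbb{R}$ satisfy $a>0$ and $|b|\ge 2(a+1)$. Consider the planar homogeneous cubic system \[ \dot x=-a(x^2+y^2)x+b(x^2-y^2)x-(x^2+y^2)y, \] \[ \dot y=-a(x^2+y^2)y+b(x^2-y^2)y+(x^2+y^2)x, \] and let $f_{a,b}:\mathbb{R}^2\to\mathbb{R}^2$ denote the vector field given by its right-hand side. Then the origin is globally asymptotically stable for this system, but there is no positive definite homogeneous polynomial $P:\mathbb{R}^2\to\mathbb{R}$ (of any degree) satisfying $\mathcal{L}_{f_{a,b}}P\le 0$ on $\mathbb{R}^2$.
   Context: For a differentiable function $P:\mathbb{R}^2\to\mathbb{R}$ and a vector field $f$, the Lie derivative is $\mathcal{L}_f P(z)=\nabla P(z)\cdot f(z)$. A function $P:\mathbb{R}^2\to\mathbb{R}$ is positive definite if $P(0)=0$ and $P(z)>0$ for $z\neq 0$. Polynomials have real coefficients. The origin is globally asymptotically stable if it is Lyapunov stable and every solution exists for all forward time and converges to the origin as $t\to\infty$. *)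

theory Defs
  imports "HOL-Analysis.Analysis"
begin

text \<open>For \<open>P\<close> differentiable at \<open>z\<close> the gradient is the unique \<open>D\<close> with \<open>GDERIV P z :> D\<close>;
  at other points the value is unspecified.\<close>

definition gradient :: "('a::euclidean_space \<Rightarrow> real) \<Rightarrow> 'a \<Rightarrow> 'a" where
  "gradient P z = (THE D. GDERIV P z :> D)"

definition lie_derivative :: "('a::euclidean_space \<Rightarrow> 'a) \<Rightarrow> ('a \<Rightarrow> real) \<Rightarrow> 'a \<Rightarrow> real" where
  "lie_derivative f P z = gradient P z \<bullet> f z"

definition positive_definite :: "('a::euclidean_space \<Rightarrow> real) \<Rightarrow> bool" where
  "positive_definite P \<longleftrightarrow> P 0 = 0 \<and> (\<forall>z. z \<noteq> 0 \<longrightarrow> P z > 0)"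

definition homogeneous_polynomial :: "nat \<Rightarrow> (real^2 \<Rightarrow> real) \<Rightarrow> bool" where
  "homogeneous_polynomial d P \<longleftrightarrow>
     (\<exists>c :: nat \<Rightarrow> real. \<forall>z. P z = (\<Sum>i\<le>d. c i * (z $ 1) ^ i * (z $ 2) ^ (d - i)))"

text \<open>Time sets are \<open>{0..<\<tau>}\<close> or \<open>{0..}\<close>, so the derivative is one-sided at the initial
  time \<open>0\<close> and two-sided elsewhere.\<close>

definition is_solution :: "('a::euclidean_space \<Rightarrow> 'a) \<Rightarrow> real set \<Rightarrow> (real \<Rightarrow> 'a) \<Rightarrow> bool" where
  "is_solution f T x \<longleftrightarrow> (\<forall>t\<in>T. (x has_vector_derivative f (x t)) (at t within T))"

definition lyapunov_stable :: "('a::euclidean_space \<Rightarrow> 'a) \<Rightarrow> bool" where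
  "lyapunov_stable f \<longleftrightarrow>
     (\<forall>\<epsilon>>0. \<exists>\<delta>>0. \<forall>\<tau> x. is_solution f {0..<\<tau>} x \<and> norm (x 0) < \<delta> \<longrightarrow>
        (\<forall>t\<in>{0..<\<tau>}. norm (x t) < \<epsilon>))"

text \<open>Every solution on a bounded forward interval extends to \<open>{0..}\<close>. The first conjunct
  rules out that this holds only for lack of solutions.\<close>

definition forward_complete :: "('a::euclidean_space \<Rightarrow> 'a) \<Rightarrow> bool" where
  "forward_complete f \<longleftrightarrow>
     (\<forall>z. \<exists>x. is_solution f {0..} x \<and> x 0 = z) \<and>
     (\<forall>\<tau> x. is_solution f {0..<\<tau>} x \<longrightarrow>
        (\<exists>y. is_solution f {0..} y \<and> (\<forall>t\<in>{0..<\<tau>}. y t = x t)))"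

definition globally_asymptotically_stable :: "('a::euclidean_space \<Rightarrow> 'a) \<Rightarrow> bool" where
  "globally_asymptotically_stable f \<longleftrightarrow>
     lyapunov_stable f \<and> forward_complete f \<and>
     (\<forall>x. is_solution f {0..} x \<longrightarrow> (x \<longlongrightarrow> 0) at_top)"

definition cubic_field :: "real \<Rightarrow> real \<Rightarrow> real^2 \<Rightarrow> real^2" where
  "cubic_field a b z =
     (let x = z $ 1; y = z $ 2 in
      vector [- a * (x\<^sup>2 + y\<^sup>2) * x + b * (x\<^sup>2 - y\<^sup>2) * x - (x\<^sup>2 + y\<^sup>2) * y,
              - a * (x\<^sup>2 + y\<^sup>2) * y + b * (x\<^sup>2 - y\<^sup>2) * y + (x\<^sup>2 + y\<^sup>2) * x])"

end

theory Submission
  imports Defs "HOL-Computational_Algebra.Fundamental_Theorem_Algebra"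
begin

text \<open>Stability: in polar coordinates \<open>r' = r\<^sup>3 (b cos 2\<theta> - a)\<close> and \<open>\<theta>' = r\<^sup>2\<close>, so
  \<open>V = r\<^sup>2 exp (- b sin 2\<theta>)\<close> satisfies \<open>V' = - 2 a r\<^sup>2 V\<close>, and \<open>V\<close> is comparable to \<open>r\<^sup>2\<close>.

  Polynomials: if \<open>P\<close> is homogeneous of degree \<open>d\<close> and \<open>G \<theta> = P (cos \<theta>, sin \<theta>) > 0\<close>, then
  \<open>P\<close> being nonincreasing along the flow means \<open>G' / G \<le> d (a - b cos 2\<theta>)\<close>. Integrated over
  a period against the weight \<open>W = 1 + sgn b cos 2\<theta>\<close>, the right-hand side gives
  \<open>\<pi> d (2 a - \<bar>b\<bar>) \<le> - 2 \<pi> d\<close>. On the other hand \<open>G\<^sup>2\<close> is a constant times a product of \<open>d\<close>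
  positive quadratic forms \<open>q\<close>, by the fundamental theorem of algebra, and for each of them the
  integral of \<open>W q' / q\<close> exceeds \<open>- 4 \<pi>\<close>. Instead of integrals, the proof compares with
  derivatives of \<open>2 \<pi>\<close>-periodic functions.\<close>

section \<open>Lie derivatives and homogeneous polynomials in the plane\<close>

lemma lie_derivative_eq:
  assumes "(P has_derivative P') (at z)"
  shows "lie_derivative f P z = P' (f z)"
proof -
  have "linear P'"
    using assms has_derivative_linear by blast
  define D where "D = adjoint P' 1"
  have D: "h \<bullet> D = P' h" for h
    using adjoint_works[OF \<open>linear P'\<close>, of h 1] by (simp add: D_def)
  have G: "GDERIV P z :> D"
    using assms by (simp add: gderiv_def D)
  have "gradient P z = D"
    unfolding gradient_def
  proof (rule the_equality)
    show "GDERIV P z :> D" by (rule G)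
  next
    fix D' assume "GDERIV P z :> D'"
    then have "(\<lambda>h. h \<bullet> D') = (\<lambda>h. h \<bullet> D)"
      using G unfolding gderiv_def by (rule has_derivative_unique)
    then show "D' = D"
      by (metis inner_commute vector_eq_rdot)
  qed
  then show ?thesis
    by (metis D inner_commute lie_derivative_def)
qed

lemma cubic_field_nth:
  "cubic_field a b z $ 1 = - a * ((z $ 1)\<^sup>2 + (z $ 2)\<^sup>2) * z $ 1
     + b * ((z $ 1)\<^sup>2 - (z $ 2)\<^sup>2) * z $ 1 - ((z $ 1)\<^sup>2 + (z $ 2)\<^sup>2) * z $ 2"
  "cubic_field a b z $ 2 = - a * ((z $ 1)\<^sup>2 + (z $ 2)\<^sup>2) * z $ 2
     + b * ((z $ 1)\<^sup>2 - (z $ 2)\<^sup>2) * z $ 2 + ((z $ 1)\<^sup>2 + (z $ 2)\<^sup>2) * z $ 1"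
  by (simp_all add: cubic_field_def Let_def vector_2)

lemma vec2_eq_axis: "(z :: real^2) = z $ 1 *\<^sub>R axis 1 1 + z $ 2 *\<^sub>R axis 2 1"
  by (simp add: vec_eq_iff forall_2 axis_def)

lemma has_vector_derivative_vec2_iff:
  fixes x :: "real \<Rightarrow> real^2"
  shows "(x has_vector_derivative d) (at t within T) \<longleftrightarrow>
    ((\<lambda>s. x s $ 1) has_real_derivative d $ 1) (at t within T) \<and>
    ((\<lambda>s. x s $ 2) has_real_derivative d $ 2) (at t within T)" (is "?L \<longleftrightarrow> ?R")
proof
  assume ?L then show ?R
    using bounded_linear.has_vector_derivative[OF bounded_linear_vec_nth]
    by (metis (no_types) has_real_derivative_iff_has_vector_derivative)
next
  assume ?R
  then have "((\<lambda>s. x s $ 1 *\<^sub>R axis 1 1 + x s $ 2 *\<^sub>R axis 2 1 :: real^2) has_vector_derivative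
      d $ 1 *\<^sub>R axis 1 1 + d $ 2 *\<^sub>R axis 2 1) (at t within T)"
    by (auto intro!: derivative_eq_intros)
  then show ?L
    by (simp flip: vec2_eq_axis)
qed

lemma homogeneous_polynomial_differentiable:
  assumes "homogeneous_polynomial d P"
  shows "P differentiable at z"
proof -
  obtain c where "P = (\<lambda>z. \<Sum>i\<le>d. c i * (z $ 1) ^ i * (z $ 2) ^ (d - i))"
    using assms unfolding homogeneous_polynomial_def by blast
  moreover have "(\<lambda>z::real^2. z $ i) differentiable at z" for i
    using bounded_linear_imp_differentiable bounded_linear_vec_nth by blast
  ultimately show ?thesis
    by (auto intro!: differentiable_sum differentiable_mult differentiable_power)
qed

lemma homogeneous_polynomial_scaleR:
  assumes "homogeneous_polynomial d P"
  shows "P (r *\<^sub>R z) = r ^ d * P z"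
proof -
  obtain c where "P = (\<lambda>z. \<Sum>i\<le>d. c i * (z $ 1) ^ i * (z $ 2) ^ (d - i))"
    using assms unfolding homogeneous_polynomial_def by blast
  then show ?thesis
    by (auto simp: sum_distrib_left power_mult_distrib mult_ac simp flip: power_add
        intro!: sum.cong)
qed

definition unit_circle :: "real \<Rightarrow> real^2" where
  "unit_circle \<theta> = vector [cos \<theta>, sin \<theta>]"

lemma unit_circle_nth [simp]: "unit_circle \<theta> $ 1 = cos \<theta>" "unit_circle \<theta> $ 2 = sin \<theta>"
  by (simp_all add: unit_circle_def vector_2)

text \<open>On the unit circle the field has radial component \<open>b cos 2\<theta> - a\<close> and tangential
  component \<open>1\<close>.\<close>

lemma homogeneous_lie_derivative_unit_circle:
  assumes P: "homogeneous_polynomial d P"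
  shows "((\<lambda>\<theta>. P (unit_circle \<theta>)) has_real_derivative
           lie_derivative (cubic_field a b) P (unit_circle \<theta>)
           - d * (b * cos (2 * \<theta>) - a) * P (unit_circle \<theta>)) (at \<theta>)"
proof -
  define k where "k = b * cos (2 * \<theta>) - a"
  obtain P' where P': "(P has_derivative P') (at (unit_circle \<theta>))"
    using homogeneous_polynomial_differentiable[OF P] unfolding differentiable_def by blast
  interpret P': bounded_linear P' using P' by (rule has_derivative_bounded_linear)
  \<comment> \<open>What remains of the field after removing its radial part; it turns out to be the
    velocity of \<open>unit_circle\<close>.\<close>
  define w where "w = cubic_field a b (unit_circle \<theta>) - k *\<^sub>R unit_circle \<theta>"
  have kc: "b * ((cos \<theta>)\<^sup>2 - (sin \<theta>)\<^sup>2) - a = k"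
    by (simp add: k_def cos_double)
  have w: "w $ 1 = - sin \<theta>" "w $ 2 = cos \<theta>"
    by (simp_all add: w_def cubic_field_nth flip: kc) (simp_all add: algebra_simps)
  have circ: "(unit_circle has_vector_derivative w) (at \<theta>)"
    unfolding has_vector_derivative_vec2_iff w by (auto intro!: derivative_eq_intros)
  have "((\<lambda>s. P (unit_circle s)) has_vector_derivative P' w) (at \<theta>)"
    using vector_derivative_diff_chain_within[of unit_circle w \<theta> UNIV P P'] circ P'
    by (simp add: o_def has_derivative_at_withinI)
  \<comment> \<open>Euler's identity, by differentiating both sides of P (s z) = s ^ d P z at s =
    1.\<close>
  moreover have "P' (unit_circle \<theta>) = d * P (unit_circle \<theta>)"
  proof -
    let ?g = "\<lambda>s. s *\<^sub>R unit_circle \<theta>"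
    have "(?g has_vector_derivative unit_circle \<theta>) (at 1)"
      by (auto intro!: derivative_eq_intros)
    then have "((\<lambda>s. P (?g s)) has_vector_derivative P' (unit_circle \<theta>)) (at 1)"
      using vector_derivative_diff_chain_within[of ?g "unit_circle \<theta>" 1 UNIV P P'] P'
      by (simp add: o_def has_derivative_at_withinI)
    then have "((\<lambda>s. s ^ d * P (unit_circle \<theta>)) has_real_derivative P' (unit_circle \<theta>)) (at 1)"
      by (simp add: homogeneous_polynomial_scaleR[OF P] has_real_derivative_iff_has_vector_derivative)
    moreover have "((\<lambda>s. s ^ d * P (unit_circle \<theta>)) has_real_derivative d * P (unit_circle \<theta>)) (at 1)"
      by (auto intro!: derivative_eq_intros)
    ultimately show ?thesis
      by (rule DERIV_unique)
  qed
  moreover have "P' (cubic_field a b (unit_circle \<theta>)) = k * P' (unit_circle \<theta>) + P' w"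
    by (simp add: w_def P'.diff P'.scaleR)
  ultimately show ?thesis
    by (simp add: lie_derivative_eq[OF P'] has_real_derivative_iff_has_vector_derivative k_def mult_ac)
qed

section \<open>Weighted logarithmic derivatives of positive quadratic forms\<close>

lemma quadratic_form_log_derivative_bound:
  fixes A B C \<sigma> :: real
  defines "q \<equiv> \<lambda>\<theta>. A - B * cos (2 * \<theta>) - C * sin (2 * \<theta>)"
    and "q' \<equiv> \<lambda>\<theta>. 2 * B * sin (2 * \<theta>) - 2 * C * cos (2 * \<theta>)"
  assumes A: "B\<^sup>2 + C\<^sup>2 < A\<^sup>2" "A > 0" and \<sigma>: "\<bar>\<sigma>\<bar> = 1"
  shows "\<exists>H H'. (\<forall>\<theta>. (H has_real_derivative H' \<theta>) (at \<theta>)) \<and> H (2 * pi) = H 0 \<and>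
    (\<forall>\<theta>. H' \<theta> - 2 < q' \<theta> / q \<theta> * (1 + \<sigma> * cos (2 * \<theta>)))"
proof (cases "B\<^sup>2 + C\<^sup>2 = 0")
  \<comment> \<open>Here \<open>q\<close> is constant and the divisions by R below would be
    meaningless, but \<open>q'\<close> vanishes and H = 0 works.\<close>
  case True
  then have "B = 0" "C = 0" by (simp_all add: sum_power2_eq_zero_iff)
  then show ?thesis by (intro exI[of _ "\<lambda>_. 0"]) (simp add: q'_def)
next
  case False
  define R where "R = sqrt (B\<^sup>2 + C\<^sup>2)"
  have R2: "R\<^sup>2 = B\<^sup>2 + C\<^sup>2" and R0: "R > 0"
    using False by (simp_all add: R_def sum_power2_gt_zero_iff)
  have RA: "R < A"
    using A R2 by (metis less_eq_real_def power2_less_imp_less)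
  define S where "S = (\<lambda>\<theta>. B * sin (2 * \<theta>) - C * cos (2 * \<theta>))"
  define E where "E = (\<lambda>\<theta>. B * cos (2 * \<theta>) + C * sin (2 * \<theta>))"
  \<comment> \<open>The maximum of (R - E) / (A - E) over E in [-R, R], attained at E = -R; it is
    below 1 because R < A.\<close>
  define \<kappa> where "\<kappa> = 2 * R / (A + R)"
  have k: "0 < \<kappa>" "\<kappa> < 1" using R0 RA by (auto simp: \<kappa>_def)
  have sq: "(S \<theta>)\<^sup>2 + (E \<theta>)\<^sup>2 = R\<^sup>2" for \<theta>
  proof -
    have "(S \<theta>)\<^sup>2 + (E \<theta>)\<^sup>2 = (B\<^sup>2 + C\<^sup>2) * ((sin (2 * \<theta>))\<^sup>2 + (cos (2 * \<theta>))\<^sup>2)"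
      unfolding S_def E_def by algebra
    then show ?thesis by (simp add: R2)
  qed
  have E: "\<bar>E \<theta>\<bar> \<le> R" for \<theta>
    using sq[of \<theta>] R0 by (metis abs_le_square_iff abs_of_pos le_add_same_cancel2 zero_le_power2)
  have q: "q \<theta> = A - E \<theta>" for \<theta> by (simp add: q_def E_def)
  have q_pos: "q \<theta> > 0" for \<theta> using E[of \<theta>] RA unfolding q by linarith
  have q': "q' \<theta> = 2 * S \<theta>" for \<theta> by (simp add: q'_def S_def)
  have dq: "(q has_real_derivative 2 * S \<theta>) (at \<theta>)" for \<theta>
    unfolding q_def S_def by (auto intro!: derivative_eq_intros)
  have dS: "(S has_real_derivative 2 * E \<theta>) (at \<theta>)" for \<theta>
    unfolding S_def E_def by (auto intro!: derivative_eq_intros)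
  have cosE: "R\<^sup>2 * cos (2 * \<theta>) = B * E \<theta> - C * S \<theta>" for \<theta>
    unfolding R2 E_def S_def by (simp add: power2_eq_square algebra_simps)
  \<comment> \<open>With \<open>E = R cos u\<close> and \<open>S = R sin u\<close>, this is \<open>R sin\<^sup>2 u / (A - R cos u) \<le> \<kappa> (1 + cos u)\<close>;
    \<open>\<kappa> < 1\<close> makes the final estimate strict.\<close>
  have S_bound: "(S \<theta>)\<^sup>2 / q \<theta> \<le> \<kappa> * (R + E \<theta>)" for \<theta>
  proof -
    have "(A + R) * (R - E \<theta>) \<le> 2 * R * (A - E \<theta>)"
    proof -
      have "0 \<le> (A - R) * (R + E \<theta>)" using E[of \<theta>] RA by (intro mult_nonneg_nonneg) auto
      then show ?thesis by (simp add: algebra_simps)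
    qed
    then have "R - E \<theta> \<le> \<kappa> * q \<theta>"
      using R0 RA by (simp add: \<kappa>_def q field_simps)
    moreover have "0 \<le> R + E \<theta>" using E[of \<theta>] by linarith
    ultimately have "(R - E \<theta>) * (R + E \<theta>) \<le> \<kappa> * q \<theta> * (R + E \<theta>)"
      by (rule mult_right_mono)
    moreover have "(S \<theta>)\<^sup>2 = (R - E \<theta>) * (R + E \<theta>)"
      using sq[of \<theta>] by (simp add: power2_eq_square algebra_simps)
    ultimately show ?thesis
      using q_pos[of \<theta>] by (simp add: field_simps)
  qed
  have C: "\<bar>C\<bar> \<le> R" unfolding R_def by (simp add: real_le_rsqrt)
  define H where "H = (\<lambda>\<theta>. ln (q \<theta>) + \<sigma> * (B / R\<^sup>2) * (A * ln (q \<theta>) - q \<theta>)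
      - \<bar>C\<bar> * \<kappa> / R\<^sup>2 * S \<theta>)"
  define H' where "H' = (\<lambda>\<theta>. 2 * S \<theta> / q \<theta> + \<sigma> * (B / R\<^sup>2) * (2 * S \<theta> * E \<theta> / q \<theta>)
      - \<bar>C\<bar> * \<kappa> / R\<^sup>2 * (2 * E \<theta>))"
  have "(H has_real_derivative H' \<theta>) (at \<theta>)" for \<theta>
  proof -
    have e: "A * (2 * S \<theta> / q \<theta>) - 2 * S \<theta> = 2 * S \<theta> * E \<theta> / q \<theta>"
      using q_pos[of \<theta>] by (simp add: q field_simps)
    define m n where "m = \<sigma> * (B / R\<^sup>2)" and "n = \<bar>C\<bar> * \<kappa> / R\<^sup>2"
    show ?thesis
      unfolding H_def H'_def e[symmetric] m_def[symmetric] n_def[symmetric]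
      using q_pos[of \<theta>] by (auto intro!: derivative_eq_intros dq dS)
  qed
  moreover have "H (2 * pi) = H 0"
  proof -
    have "cos (4 * pi) = 1" "sin (4 * pi) = 0"
      using cos_2npi[of 2] sin_2npi[of 2] by simp_all
    then show ?thesis by (simp add: H_def q_def S_def)
  qed
  moreover have "H' \<theta> - 2 < q' \<theta> / q \<theta> * (1 + \<sigma> * cos (2 * \<theta>))" for \<theta>
  proof -
    have c: "cos (2 * \<theta>) = B / R\<^sup>2 * E \<theta> - C / R\<^sup>2 * S \<theta>"
      using cosE[of \<theta>] R0 by (simp add: field_simps)
    have "q' \<theta> / q \<theta> * (1 + \<sigma> * cos (2 * \<theta>)) - H' \<theta>
       = \<bar>C\<bar> * \<kappa> / R\<^sup>2 * (2 * E \<theta>) - \<sigma> * C * 2 / R\<^sup>2 * ((S \<theta>)\<^sup>2 / q \<theta>)"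
      unfolding c q' H'_def by (simp add: algebra_simps power2_eq_square add_divide_distrib diff_divide_distrib)
    also have "\<dots> \<ge> \<bar>C\<bar> * \<kappa> / R\<^sup>2 * (2 * E \<theta>) - \<bar>C\<bar> * 2 / R\<^sup>2 * (\<kappa> * (R + E \<theta>))"
    proof -
      have "\<sigma> * C * 2 / R\<^sup>2 * ((S \<theta>)\<^sup>2 / q \<theta>) \<le> \<bar>C\<bar> * 2 / R\<^sup>2 * ((S \<theta>)\<^sup>2 / q \<theta>)"
        using \<sigma> q_pos[of \<theta>]
        by (intro mult_right_mono divide_right_mono) (auto simp: abs_if split: if_splits)
      also have "\<dots> \<le> \<bar>C\<bar> * 2 / R\<^sup>2 * (\<kappa> * (R + E \<theta>))"
        by (intro mult_left_mono S_bound) auto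
      finally show ?thesis by simp
    qed
    also have "\<bar>C\<bar> * \<kappa> / R\<^sup>2 * (2 * E \<theta>) - \<bar>C\<bar> * 2 / R\<^sup>2 * (\<kappa> * (R + E \<theta>)) = - 2 * \<kappa> * (\<bar>C\<bar> / R)"
      using R0 by (simp add: field_simps power2_eq_square)
    finally have "q' \<theta> / q \<theta> * (1 + \<sigma> * cos (2 * \<theta>)) - H' \<theta> \<ge> - 2 * \<kappa> * (\<bar>C\<bar> / R)" .
    moreover have "\<kappa> * (\<bar>C\<bar> / R) \<le> \<kappa> * 1"
      using C R0 k by (intro mult_left_mono) auto
    ultimately show ?thesis using k by linarith
  qed
  ultimately show ?thesis by blast
qed

section \<open>Factorization and the nonexistence of polynomial Lyapunov functions\<close>

text \<open>Because c d is nonzero, the dehomogenized polynomial \<open>p\<close> has degree exactly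
  \<open>d\<close> and splits into \<open>d\<close> complex linear factors. Substituting x / y and
  multiplying by y ^ d restores the homogeneous form.\<close>

lemma homogeneous_polynomial_factorization:
  fixes P :: "real^2 \<Rightarrow> real"
  assumes "\<And>z. P z = (\<Sum>i\<le>d. c i * (z $ 1) ^ i * (z $ 2) ^ (d - i))" and "c d \<noteq> 0"
  shows "\<exists>t :: nat \<Rightarrow> complex. \<forall>z.
    of_real (P z) = of_real (c d) * (\<Prod>i<d. of_real (z $ 1) - t i * of_real (z $ 2))"
proof -
  define p :: "complex poly" where "p = (\<Sum>i\<le>d. monom (of_real (c i)) i)"
  have cp: "coeff p i = (if i \<le> d then of_real (c i) else 0)" for i
    by (simp add: p_def coeff_sum)
  have deg: "degree p = d"
    using \<open>c d \<noteq> 0\<close> by (intro antisym degree_le le_degree) (auto simp: cp)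
  obtain t where t: "smult (lead_coeff p) (\<Prod>i<degree p. [:- t i, 1:]) = p"
    by (rule complex_poly_decompose')
  have p1: "poly p w = of_real (c d) * (\<Prod>i<d. w - t i)" for w
    by (subst t[symmetric]) (simp add: poly_prod deg cp)
  have p2: "poly p w = (\<Sum>i\<le>d. of_real (c i) * w ^ i)" for w
    by (simp add: p_def poly_sum poly_monom)
  show ?thesis
  proof (intro exI allI)
    fix z :: "real^2"
    let ?x = "of_real (z $ 1) :: complex" and ?y = "of_real (z $ 2) :: complex"
    show "of_real (P z) = of_real (c d) * (\<Prod>i<d. ?x - t i * ?y)"
    proof (cases "z $ 2 = 0")
      case True
      have "(\<Sum>i\<le>d. c i * (z $ 1) ^ i * (z $ 2) ^ (d - i)) = (\<Sum>i\<in>{d}. c i * (z $ 1) ^ i)"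
        using True by (intro sum.mono_neutral_cong_right) (auto simp: power_0_left)
      then show ?thesis using True assms(1)[of z] by simp
    next
      case False
      have "(\<Sum>i\<le>d. of_real (c i) * ?x ^ i * ?y ^ (d - i)) = ?y ^ d * poly p (?x / ?y)"
        unfolding p2 sum_distrib_left
        using False by (intro sum.cong) (auto simp: power_divide power_diff)
      also have "\<dots> = of_real (c d) * (\<Prod>i<d. ?y * (?x / ?y - t i))"
        unfolding p1 by (simp add: prod.distrib)
      also have "(\<Prod>i<d. ?y * (?x / ?y - t i)) = (\<Prod>i<d. ?x - t i * ?y)"
        using False by (intro prod.cong) (auto simp: field_simps)
      finally show ?thesis using assms(1)[of z] by simp
    qed
  qed
qed

lemma no_polynomial_lyapunov_function:
  fixes a b :: real
  assumes ab: "\<bar>b\<bar> \<ge> 2 * (a + 1)"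
    and P: "homogeneous_polynomial d P" and pd: "positive_definite P"
    and lie: "\<And>z. lie_derivative (cubic_field a b) P z \<le> 0"
  shows False
proof -
  obtain c where c: "\<And>z. P z = (\<Sum>i\<le>d. c i * (z $ 1) ^ i * (z $ 2) ^ (d - i))"
    using P unfolding homogeneous_polynomial_def by blast
  have pos: "P z > 0" if "z $ 1 \<noteq> 0 \<or> z $ 2 \<noteq> 0" for z
    using pd that unfolding positive_definite_def by (metis zero_index)
  \<comment> \<open>At (1, 0) only the term \<open>i = d\<close> survives, so positivity of
    \<open>P\<close> gives the leading coefficient needed for the factorization.\<close>
  have "P (unit_circle 0) = (\<Sum>i\<in>{d}. c i)"
    unfolding c by (intro sum.mono_neutral_cong_right) (auto simp: power_0_left)
  then have cd: "c d > 0" using pos[of "unit_circle 0"] by simp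
  have "d \<noteq> 0"
  proof
    assume "d = 0"
    then have "P 0 = c d" by (simp add: c)
    then show False using cd pd by (simp add: positive_definite_def)
  qed
  obtain t :: "nat \<Rightarrow> complex" where
    t: "\<And>z. of_real (P z) = of_real (c d) * (\<Prod>i<d. of_real (z $ 1) - t i * of_real (z $ 2))"
    using homogeneous_polynomial_factorization[of P c d, OF c] less_imp_neq[OF cd] by metis
  \<comment> \<open>A real root t i would make \<open>P\<close> vanish at the nonzero point (t i,
    1).\<close>
  have imt: "Im (t i) \<noteq> 0" if "i < d" for i
  proof
    assume "Im (t i) = 0"
    then have "of_real (Re (t i)) = t i" by (simp add: complex_eq_iff)
    define z :: "real^2" where "z = vector [Re (t i), 1]"
    have "of_real (P z) = (0 :: complex)"
      unfolding t using that \<open>of_real (Re (t i)) = t i\<close>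
      by (simp add: z_def vector_2) (metis eq_iff_diff_eq_0 lessThan_iff)
    then show False using pos[of z] by (simp add: z_def vector_2)
  qed
  define A where "A i = (1 + (cmod (t i))\<^sup>2) / 2" for i
  define B where "B i = ((cmod (t i))\<^sup>2 - 1) / 2" for i
  define C where "C i = Re (t i)" for i
  define q where "q i \<theta> = A i - B i * cos (2 * \<theta>) - C i * sin (2 * \<theta>)" for i \<theta>
  define q' where "q' i \<theta> = 2 * B i * sin (2 * \<theta>) - 2 * C i * cos (2 * \<theta>)" for i \<theta>
  have ABC: "(B i)\<^sup>2 + (C i)\<^sup>2 < (A i)\<^sup>2" if "i < d" for i
  proof -
    have "(A i)\<^sup>2 - (B i)\<^sup>2 = (cmod (t i))\<^sup>2"
      by (simp add: A_def B_def power2_eq_square field_simps)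
    moreover have "(cmod (t i))\<^sup>2 = (C i)\<^sup>2 + (Im (t i))\<^sup>2" by (simp add: cmod_power2 C_def)
    moreover have "(Im (t i))\<^sup>2 > 0" using imt[OF that] by simp
    ultimately show ?thesis by linarith
  qed
  have q_eq: "(cmod (of_real (cos \<theta>) - t i * of_real (sin \<theta>)))\<^sup>2 = q i \<theta>" for i \<theta>
  proof -
    have "q i \<theta> = A i * ((cos \<theta>)\<^sup>2 + (sin \<theta>)\<^sup>2) - B i * ((cos \<theta>)\<^sup>2 - (sin \<theta>)\<^sup>2)
        - C i * (2 * sin \<theta> * cos \<theta>)"
      by (simp add: q_def cos_double sin_double)
    also have "\<dots> = (cos \<theta> - Re (t i) * sin \<theta>)\<^sup>2 + (Im (t i) * sin \<theta>)\<^sup>2"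
      unfolding A_def B_def C_def cmod_power2
      by (simp add: power2_eq_square field_simps del: sin_cos_squared_add sin_cos_squared_add2
          sin_cos_squared_add3)
    finally show ?thesis by (simp add: cmod_power2)
  qed
  define G where "G \<theta> = P (unit_circle \<theta>)" for \<theta>
  define G' where "G' \<theta> = lie_derivative (cubic_field a b) P (unit_circle \<theta>)
      - d * (b * cos (2 * \<theta>) - a) * G \<theta>" for \<theta>
  have dG: "(G has_real_derivative G' \<theta>) (at \<theta>)" for \<theta>
    unfolding G_def[abs_def] G'_def
    by (rule homogeneous_lie_derivative_unit_circle[OF P])
  have G_pos: "G \<theta> > 0" for \<theta>
    unfolding G_def by (rule pos) (use sin_zero_abs_cos_one[of \<theta>] in auto)
  \<comment> \<open>Squaring replaces every complex factor by its squared modulus, so each root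
    gives a real form without pairing conjugate roots.\<close>
  have G2: "(G \<theta>)\<^sup>2 = (c d)\<^sup>2 * (\<Prod>i<d. q i \<theta>)" for \<theta>
  proof -
    have "(G \<theta>)\<^sup>2 = (cmod (of_real (G \<theta>)))\<^sup>2" by simp
    then show ?thesis
      unfolding G_def t by (simp add: norm_mult power_mult_distrib prod_power_distrib q_eq flip: prod_norm)
  qed
  have q_pos: "q i \<theta> > 0" if "i < d" for i \<theta>
  proof -
    have "(\<Prod>i<d. q i \<theta>) \<noteq> 0"
      using G2[of \<theta>] G_pos[of \<theta>] by (metis less_irrefl mult_zero_right zero_eq_power2)
    then have "q i \<theta> \<noteq> 0" using that by auto
    then show ?thesis using q_eq[of \<theta> i] by (metis less_eq_real_def zero_le_power2)
  qed
  have log_deriv: "2 * G' \<theta> / G \<theta> = (\<Sum>i<d. q' i \<theta> / q i \<theta>)" for \<theta>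
  proof -
    have eq: "2 * ln (G s) = 2 * ln (c d) + (\<Sum>i<d. ln (q i s))" for s
    proof -
      have "ln ((G s)\<^sup>2) = ln ((c d)\<^sup>2 * (\<Prod>i<d. q i s))" by (simp add: G2)
      also have "\<dots> = ln ((c d)\<^sup>2) + ln (\<Prod>i<d. q i s)"
        using cd q_pos by (intro ln_mult_pos prod_pos) auto
      also have "ln (\<Prod>i<d. q i s) = (\<Sum>i<d. ln (q i s))"
        using q_pos by (intro ln_prod) (simp, metis lessThan_iff less_irrefl)
      finally show ?thesis using G_pos cd by (simp add: ln_realpow)
    qed
    have "((\<lambda>s. 2 * ln (G s)) has_real_derivative 2 * G' \<theta> / G \<theta>) (at \<theta>)"
      using G_pos[of \<theta>] by (auto intro!: derivative_eq_intros dG)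
    moreover have "((\<lambda>s. 2 * ln (c d) + (\<Sum>i<d. ln (q i s))) has_real_derivative
        0 + (\<Sum>i<d. q' i \<theta> / q i \<theta>)) (at \<theta>)"
    proof -
      have "((\<lambda>s. ln (q i s)) has_real_derivative q' i \<theta> / q i \<theta>) (at \<theta>)" if "i < d" for i
        using q_pos[OF that, of \<theta>] unfolding q_def q'_def by (auto intro!: derivative_eq_intros)
      then show ?thesis by (intro DERIV_add DERIV_const DERIV_sum) auto
    qed
    ultimately show ?thesis unfolding eq using DERIV_unique by force
  qed
  \<comment> \<open>The sign of \<open>b\<close>, with value 1 at b = 0 so that its modulus is
    always 1.\<close>
  define \<sigma> where "\<sigma> = (if b \<ge> 0 then 1 else -1 :: real)"
  have \<sigma>: "\<bar>\<sigma>\<bar> = 1" "\<sigma> * b = \<bar>b\<bar>" by (auto simp: \<sigma>_def)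
  have "\<exists>H H'. (\<forall>\<theta>. (H has_real_derivative H' \<theta>) (at \<theta>)) \<and> H (2 * pi) = H 0 \<and>
    (\<forall>\<theta>. H' \<theta> - 2 < q' i \<theta> / q i \<theta> * (1 + \<sigma> * cos (2 * \<theta>)))" if "i < d" for i
    using quadratic_form_log_derivative_bound[OF ABC[OF that] _ \<sigma>(1)]
    unfolding q_def q'_def A_def by (simp add: add_pos_nonneg)
  then obtain H H' where H: "\<And>i \<theta>. i < d \<Longrightarrow> (H i has_real_derivative H' i \<theta>) (at \<theta>)"
      "\<And>i. i < d \<Longrightarrow> H i (2 * pi) = H i 0"
      "\<And>i \<theta>. i < d \<Longrightarrow> H' i \<theta> - 2 < q' i \<theta> / q i \<theta> * (1 + \<sigma> * cos (2 * \<theta>))"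
    by metis
  \<comment> \<open>An antiderivative of 2 d (a - b cos 2\<theta>) (1 + \<sigma> cos 2\<theta>)
    minus its mean d (2 a - |b|), hence periodic.\<close>
  define D where "D \<theta> = 2 * d * ((\<sigma> * a - b) * sin (2 * \<theta>) / 2 - \<bar>b\<bar> * sin (4 * \<theta>) / 8)" for \<theta>
  define D' where "D' \<theta> = 2 * d * ((\<sigma> * a - b) * cos (2 * \<theta>) - \<bar>b\<bar> * cos (4 * \<theta>) / 2)" for \<theta>
  have dD: "(D has_real_derivative D' \<theta>) (at \<theta>)" for \<theta>
    unfolding D_def[abs_def] D'_def by (auto intro!: derivative_eq_intros simp: field_simps)
  have D': "D' \<theta> = 2 * d * (a - b * cos (2 * \<theta>)) * (1 + \<sigma> * cos (2 * \<theta>)) - d * (2 * a - \<bar>b\<bar>)" for \<theta>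
  proof -
    have "cos (4 * \<theta>) = 2 * (cos (2 * \<theta>))\<^sup>2 - 1"
      using cos_double_cos[of "2 * \<theta>"] by simp
    then have e: "D' \<theta> = 2 * d * ((\<sigma> * a - b) * cos (2 * \<theta>) - (\<sigma> * b) * (2 * (cos (2 * \<theta>))\<^sup>2 - 1) / 2)"
      by (simp add: D'_def \<sigma>)
    show ?thesis unfolding e \<sigma>(2)[symmetric] by (simp add: field_simps power2_eq_square)
  qed
  \<comment> \<open>The contradiction comes from \<open>K\<close>: it takes the same value at 0 and
    at 2 \<pi>, yet its derivative is below d (2 a - |b| + 2), which the hypothesis on
    \<open>b\<close> makes nonpositive.\<close>
  define K where "K \<theta> = (\<Sum>i<d. H i \<theta>) - D \<theta>" for \<theta>
  have "K (2 * pi) < K 0"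
  proof (rule DERIV_neg_imp_decreasing[of 0 "2 * pi" K])
    fix \<theta> :: real
    have "(K has_real_derivative (\<Sum>i<d. H' i \<theta>) - D' \<theta>) (at \<theta>)"
      unfolding K_def[abs_def] by (auto intro!: derivative_eq_intros H dD)
    moreover have "(\<Sum>i<d. H' i \<theta>) - D' \<theta> < 0"
    proof -
      let ?W = "1 + \<sigma> * cos (2 * \<theta>)"
      have W: "?W \<ge> 0"
      proof -
        have "\<bar>\<sigma> * cos (2 * \<theta>)\<bar> \<le> 1" by (simp add: abs_mult \<sigma>(1))
        then show ?thesis by linarith
      qed
      \<comment> \<open>Strictness needs at least one summand, that is \<open>d \<noteq> 0\<close>;
        the d slacks of size 2 add up to the 2 d that competes with d |b|.\<close>
      have "(\<Sum>i<d. H' i \<theta>) < (\<Sum>i<d. q' i \<theta> / q i \<theta> * ?W + 2)"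
        using \<open>d \<noteq> 0\<close> H(3)[of _ \<theta>] by (intro sum_strict_mono) (auto simp: algebra_simps)
      also have "\<dots> = (\<Sum>i<d. q' i \<theta> / q i \<theta>) * ?W + 2 * d"
        by (simp add: sum.distrib sum_distrib_right)
      also have "\<dots> = 2 * (G' \<theta> / G \<theta> * ?W) + 2 * d"
        by (simp flip: log_deriv)
      \<comment> \<open>The sign condition on the Lie derivative enters here; multiplying by the
        weight preserves the inequality because the weight is nonnegative.\<close>
      also have "G' \<theta> / G \<theta> * ?W \<le> d * (a - b * cos (2 * \<theta>)) * ?W"
      proof (intro mult_right_mono W)
        have "G' \<theta> \<le> d * (a - b * cos (2 * \<theta>)) * G \<theta>"
          using lie[of "unit_circle \<theta>"] by (simp add: G'_def algebra_simps)
        then show "G' \<theta> / G \<theta> \<le> d * (a - b * cos (2 * \<theta>))"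
          using G_pos[of \<theta>] by (simp add: divide_le_eq)
      qed
      finally have "(\<Sum>i<d. H' i \<theta>) - D' \<theta> < d * (2 * a - \<bar>b\<bar> + 2)"
        unfolding D' by (simp add: algebra_simps)
      also have "\<dots> \<le> 0" using ab by (intro mult_nonneg_nonpos) auto
      finally show ?thesis .
    qed
    ultimately show "\<exists>y. (K has_real_derivative y) (at \<theta>) \<and> y < 0" by blast
  qed simp
  moreover have "K (2 * pi) = K 0"
  proof -
    have "sin (4 * pi) = 0" "sin (8 * pi) = 0"
      using sin_2npi[of 2] sin_2npi[of 4] by simp_all
    then show ?thesis by (simp add: K_def D_def H(2))
  qed
  ultimately show False by simp
qed


section \<open>Derivative comparison and local Lipschitz estimates\<close>

text \<open>The mean value theorem, with derivatives relative to a larger set \<open>T\<close> so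
  that it applies to solutions, whose derivative at time 0 is one-sided.\<close>

lemma real_derivative_upper_bound:
  fixes g :: "real \<Rightarrow> real"
  assumes "s \<le> t" "{s..t} \<subseteq> T"
    and "\<And>r. r \<in> T \<Longrightarrow> (g has_real_derivative g' r) (at r within T)"
    and "\<And>r. r \<in> {s..t} \<Longrightarrow> g' r \<le> c"
  shows "g t - g s \<le> c * (t - s)"
proof -
  have "(g has_derivative (*) (g' r)) (at r within {s..t})" if "r \<in> {s..t}" for r
    using assms(2) assms(3)[of r] that
    by (metis DERIV_subset has_field_derivative_def subsetD)
  then obtain r where "r \<in> {s..t}" "g t - g s = g' r * (t - s)"
    using mvt_very_simple[OF assms(1), of g "\<lambda>r. (*) (g' r)"] by (metis atLeastAtMost_iff)
  then show ?thesis
    using assms(1,4) by (simp add: mult_right_mono)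
qed

lemma tendsto_0_if_quadratic_decay:
  fixes g :: "real \<Rightarrow> real"
  assumes deriv: "\<And>t. t \<ge> 0 \<Longrightarrow> (g has_real_derivative g' t) (at t within {0..})"
    and decay: "\<And>t. t \<ge> 0 \<Longrightarrow> g' t \<le> - c * (g t)\<^sup>2" and "c > 0"
    and nonneg: "\<And>t. t \<ge> 0 \<Longrightarrow> g t \<ge> 0"
  shows "(g \<longlongrightarrow> 0) at_top"
proof (rule tendstoI)
  fix e :: real assume "e > 0"
  have mono: "g t \<le> g s" if "0 \<le> s" "s \<le> t" for s t
  proof -
    have "g' r \<le> 0" if "r \<in> {s..t}" for r
      using decay[of r] that \<open>0 \<le> s\<close> \<open>c > 0\<close> by (smt (verit) atLeastAtMost_iff mult_minus_left mult_nonneg_nonneg zero_le_power2)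
    then show ?thesis
      using real_derivative_upper_bound[of s t "{0..}" g g' 0] deriv that by auto
  qed
  have "\<exists>s\<ge>0. g s < e"
  proof (rule ccontr)
    assume "\<not> (\<exists>s\<ge>0. g s < e)"
    then have ge: "g s \<ge> e" if "s \<ge> 0" for s using that by force
    \<comment> \<open>The time at which the linear upper bound for \<open>g\<close> reaches
      -1.\<close>
    define t where "t = (g 0 + 1) / (c * e\<^sup>2)"
    have ce: "c * e\<^sup>2 > 0" using \<open>c > 0\<close> \<open>e > 0\<close> by simp
    have "t \<ge> 0" unfolding t_def using nonneg[of 0] ce by simp
    have "g' r \<le> - c * e\<^sup>2" if "r \<in> {0..t}" for r
    proof -
      have "e\<^sup>2 \<le> (g r)\<^sup>2" using ge[of r] that \<open>e > 0\<close> by (intro power_mono) auto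
      then show ?thesis using decay[of r] that \<open>c > 0\<close>
        by (smt (verit) atLeastAtMost_iff mult_left_mono mult_minus_left)
    qed
    then have "g t - g 0 \<le> - c * e\<^sup>2 * (t - 0)"
      using \<open>t \<ge> 0\<close> deriv by (intro real_derivative_upper_bound[of 0 t "{0..}" g g']) auto
    also have "\<dots> = - (g 0 + 1)"
      using \<open>c > 0\<close> \<open>e > 0\<close> by (simp add: t_def)
    finally show False using nonneg[OF \<open>t \<ge> 0\<close>] by simp
  qed
  then obtain s where "s \<ge> 0" "g s < e" by blast
  then have "dist (g t) 0 < e" if "t \<ge> s" for t
    using mono[of s t] nonneg[of t] that by simp
  then show "\<forall>\<^sub>F t in at_top. dist (g t) 0 < e"
    using eventually_at_top_linorder by blast
qed

lemma lipschitz_on_mult_bounded: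
  fixes f g :: "'a::heine_borel \<Rightarrow> real"
  assumes "L-lipschitz_on U f" "K-lipschitz_on U g" "bounded U"
  shows "\<exists>N. N-lipschitz_on U (\<lambda>x. f x * g x)"
proof -
  have "bounded (f ` U)" "bounded (g ` U)"
    using bounded_uniformly_continuous_image[OF lipschitz_on_uniformly_continuous assms(3)] assms(1,2)
    by auto
  then obtain F G where F: "\<And>x. x \<in> U \<Longrightarrow> \<bar>f x\<bar> \<le> F" "F > 0" and G: "\<And>x. x \<in> U \<Longrightarrow> \<bar>g x\<bar> \<le> G" "G > 0"
    unfolding bounded_pos by auto
  have "(F * K + G * L)-lipschitz_on U (\<lambda>x. f x * g x)"
  proof (rule lipschitz_onI)
    fix x y assume xy: "x \<in> U" "y \<in> U"
    have "f x * g x - f y * g y = f x * (g x - g y) + g y * (f x - f y)"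
      by (simp add: algebra_simps)
    then have "dist (f x * g x) (f y * g y) \<le> \<bar>f x\<bar> * dist (g x) (g y) + \<bar>g y\<bar> * dist (f x) (f y)"
      unfolding dist_real_def by (metis abs_mult abs_triangle_ineq)
    also have "\<dots> \<le> F * (K * dist x y) + G * (L * dist x y)"
      using F G xy assms(1,2) by (intro add_mono mult_mono lipschitz_onD) auto
    finally show "dist (f x * g x) (f y * g y) \<le> (F * K + G * L) * dist x y"
      by (simp add: algebra_simps)
  next
    show "0 \<le> F * K + G * L"
      using F(2) G(2) lipschitz_on_nonneg[OF assms(1)] lipschitz_on_nonneg[OF assms(2)] by simp
  qed
  then show ?thesis by blast
qed

lemma lipschitz_on_vec2:
  fixes f :: "'a::metric_space \<Rightarrow> real^2"
  assumes "L-lipschitz_on U (\<lambda>z. f z $ 1)" "K-lipschitz_on U (\<lambda>z. f z $ 2)"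
  shows "(L + K)-lipschitz_on U f"
proof (rule lipschitz_onI)
  fix x y assume xy: "x \<in> U" "y \<in> U"
  have "dist (f x) (f y) \<le> \<bar>(f x - f y) $ 1\<bar> + \<bar>(f x - f y) $ 2\<bar>"
    using norm_le_l1_cart[of "f x - f y"] by (simp add: dist_norm sum_2)
  also have "\<dots> \<le> L * dist x y + K * dist x y"
    using lipschitz_onD[OF assms(1) xy] lipschitz_onD[OF assms(2) xy] by (simp add: dist_real_def)
  finally show "dist (f x) (f y) \<le> (L + K) * dist x y" by (simp add: algebra_simps)
qed (use assms lipschitz_on_nonneg in \<open>blast intro: add_nonneg_nonneg\<close>)

lemma cubic_field_lipschitz: "\<exists>L. L-lipschitz_on (cball 0 M) (cubic_field a b)"
proof -
  \<comment> \<open>On a ball the Lipschitz functions form a ring containing the coordinates and the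
    constants, hence both polynomial components of the field.\<close>
  define lip where "lip g \<longleftrightarrow> (\<exists>L. L-lipschitz_on (cball 0 M) g)" for g :: "real^2 \<Rightarrow> real"
  have "lip (\<lambda>z. z $ i)" for i
    unfolding lip_def
    by (intro exI[of _ 1] lipschitz_onI) (auto simp: dist_vec_nth_le)
  moreover have "lip (\<lambda>z. c)" for c
    unfolding lip_def using lipschitz_on_constant by blast
  moreover have "lip (\<lambda>z. f z * g z)" if "lip f" "lip g" for f g
    using that lipschitz_on_mult_bounded unfolding lip_def by blast
  moreover have "lip (\<lambda>z. f z + g z)" "lip (\<lambda>z. f z - g z)" if "lip f" "lip g" for f g
    using that lipschitz_on_add lipschitz_on_diff unfolding lip_def by blast+
  ultimately have "lip (\<lambda>z. cubic_field a b z $ 1)" "lip (\<lambda>z. cubic_field a b z $ 2)"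
    unfolding cubic_field_nth power2_eq_square by simp_all
  then show ?thesis
    using lipschitz_on_vec2 unfolding lip_def by blast
qed

section \<open>Uniqueness and existence of solutions\<close>

lemma is_solution_subset:
  assumes "is_solution f T x" "S \<subseteq> T"
  shows "is_solution f S x"
  unfolding is_solution_def
proof
  fix t assume "t \<in> S"
  then have "(x has_vector_derivative f (x t)) (at t within T)"
    using assms unfolding is_solution_def by auto
  then show "(x has_vector_derivative f (x t)) (at t within S)"
    using assms(2) by (rule has_vector_derivative_within_subset)
qed

lemma solution_unique:
  fixes f :: "'a::euclidean_space \<Rightarrow> 'a"
  assumes lip: "\<And>M. \<exists>L. L-lipschitz_on (cball 0 M) f"
    and x: "is_solution f {0..<\<tau>} x" and y: "is_solution f {0..<\<tau>} y"
    and "x 0 = y 0" and t: "t \<in> {0..<\<tau>}"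
  shows "x t = y t"
proof -
  have sub: "{0..t} \<subseteq> {0..<\<tau>}" using t by auto
  have dx: "(x has_vector_derivative f (x s)) (at s within {0..t})"
    and dy: "(y has_vector_derivative f (y s)) (at s within {0..t})" if "s \<in> {0..t}" for s
    using is_solution_subset[OF x sub] is_solution_subset[OF y sub] that
    unfolding is_solution_def by simp_all
  have "continuous_on {0..t} x" "continuous_on {0..t} y"
    unfolding continuous_on_eq_continuous_within
    using dx dy has_vector_derivative_continuous by metis+
  then have "bounded (x ` {0..t} \<union> y ` {0..t})"
    by (simp add: compact_imp_bounded compact_continuous_image)
  then obtain M where M: "x ` {0..t} \<union> y ` {0..t} \<subseteq> cball 0 M"
    unfolding bounded_iff by (metis mem_cball_0 subsetI)
  obtain L where L: "L-lipschitz_on (cball 0 M) f" using lip by blast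
  define w where "w s = (x s - y s) \<bullet> (x s - y s)" for s
  define w' where "w' s = 2 * ((x s - y s) \<bullet> (f (x s) - f (y s)))" for s
  have dw: "(w has_real_derivative w' s) (at s within {0..t})" if "s \<in> {0..t}" for s
    unfolding w_def[abs_def] w'_def has_real_derivative_iff_has_vector_derivative
    using bounded_bilinear.has_vector_derivative[OF bounded_bilinear_inner
        has_vector_derivative_diff[OF dx[OF that] dy[OF that]]
        has_vector_derivative_diff[OF dx[OF that] dy[OF that]]]
    by (simp add: inner_commute)
  have w': "w' s \<le> 2 * L * w s" if "s \<in> {0..t}" for s
  proof -
    have "norm (f (x s) - f (y s)) \<le> L * norm (x s - y s)"
      using that by (intro lipschitz_on_normD[OF L] subsetD[OF M]) auto
    then have "(x s - y s) \<bullet> (f (x s) - f (y s)) \<le> norm (x s - y s) * (L * norm (x s - y s))"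
      by (meson mult_left_mono norm_cauchy_schwarz norm_ge_zero order_trans)
    then show ?thesis
      by (simp add: w'_def w_def dot_square_norm power2_eq_square algebra_simps)
  qed
  \<comment> \<open>With the integrating factor exp (-2 L s), the inequality w' \<le> 2 L w says
    that the product is nonincreasing.\<close>
  have "w t * exp (- (2 * L) * t) - w 0 * exp (- (2 * L) * 0) \<le> 0 * (t - 0)"
  proof (rule real_derivative_upper_bound)
    fix s assume s: "s \<in> {0..t}"
    show "((\<lambda>s. w s * exp (- (2 * L) * s)) has_real_derivative (w' s - 2 * L * w s) * exp (- (2 * L) * s))
        (at s within {0..t})"
      by (rule derivative_eq_intros dw[OF s] refl)+ (simp add: algebra_simps)
    show "(w' s - 2 * L * w s) * exp (- (2 * L) * s) \<le> 0"
      using w'[OF s] by (simp add: mult_nonpos_nonneg)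
  qed (use t in auto)
  then have "w t * exp (- (2 * L) * t) \<le> 0" using \<open>x 0 = y 0\<close> by (simp add: w_def)
  then have "w t \<le> 0" by (simp add: mult_le_0_iff)
  moreover have "w t \<ge> 0" by (simp add: w_def)
  ultimately have "w t = 0" by (rule antisym)
  then show ?thesis by (simp add: w_def)
qed

text \<open>Separation of variables: the elapsed time \<open>T\<close> is a primitive of 1 / h
  vanishing at \<theta>0, and the solution is its inverse. The upper bound on \<open>h\<close> makes
  \<open>T\<close> grow at least linearly, so its range is the whole line and the solution is
  global.\<close>

lemma autonomous_ode_exists:
  fixes h :: "real \<Rightarrow> real"
  assumes cont: "continuous_on UNIV h" and h: "\<And>u. 0 < h u" "\<And>u. h u \<le> M"
  shows "\<exists>\<theta>. \<theta> 0 = \<theta>0 \<and> (\<forall>t. (\<theta> has_real_derivative h (\<theta> t)) (at t))"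
proof -
  have "isCont (\<lambda>u. 1 / h u) u" for u
    using cont h(1)[of u] by (intro continuous_intros) (auto simp: continuous_on_eq_continuous_at)
  then have "\<exists>F. \<forall>u. (F has_vector_derivative 1 / h u) (at u)"
    using einterval_antiderivative[of "-\<infinity>" "\<infinity>" "\<lambda>u. 1 / h u"] by simp
  then obtain F where F: "\<And>u. (F has_real_derivative 1 / h u) (at u)"
    unfolding has_real_derivative_iff_has_vector_derivative by blast
  define T where "T u = F u - F \<theta>0" for u
  have dT: "(T has_real_derivative 1 / h u) (at u)" for u
    unfolding T_def[abs_def] by (auto intro!: derivative_eq_intros F)
  have "M > 0" using h[of 0] by linarith
  have growth: "T v - T u \<ge> (v - u) / M" if "u \<le> v" for u v
  proof -
    have "- T v - - T u \<le> (- 1 / M) * (v - u)"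
    proof (rule real_derivative_upper_bound[of u v UNIV "\<lambda>u. - T u" "\<lambda>u. - (1 / h u)"])
      show "- (1 / h r) \<le> - 1 / M" for r
        using h[of r] \<open>M > 0\<close> by (simp add: frac_le)
    qed (use that in \<open>auto intro!: derivative_eq_intros dT\<close>)
    then show ?thesis by simp
  qed
  have inj: "inj T"
  proof (rule linorder_injI)
    fix u v :: real assume "u < v"
    then have "(v - u) / M > 0" using \<open>M > 0\<close> by simp
    then show "T u \<noteq> T v" using growth[of u v] \<open>u < v\<close> by linarith
  qed
  have contT: "continuous_on S T" for S
    using dT by (meson DERIV_isCont continuous_at_imp_continuous_on)
  have surj: "\<exists>u. T u = t" for t
  proof -
    \<comment> \<open>Moving this far from \<theta>0 changes \<open>T\<close> by at least |t|, so
      the intermediate value theorem reaches t.\<close>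
    define k where "k = M * \<bar>t\<bar>"
    have k: "k \<ge> 0" "k / M = \<bar>t\<bar>" using \<open>M > 0\<close> by (auto simp: k_def)
    have "T \<theta>0 = 0" by (simp add: T_def)
    then have "T (\<theta>0 - k) \<le> t" "t \<le> T (\<theta>0 + k)"
      using growth[of "\<theta>0 - k" \<theta>0] growth[of \<theta>0 "\<theta>0 + k"] k by auto
    then show ?thesis
      using IVT'[of T "\<theta>0 - k" t "\<theta>0 + k"] contT k(1) by force
  qed
  define \<theta> where "\<theta> = inv T"
  have T\<theta>: "T (\<theta> t) = t" for t
    unfolding \<theta>_def using surj by (metis f_inv_into_f rangeI)
  have \<theta>T: "\<theta> (T u) = u" for u
    unfolding \<theta>_def using inj by simp
  have "(\<theta> has_derivative (*) (h (\<theta> t))) (at t)" for t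
  proof (rule has_derivative_inverse_strong_x[of UNIV \<theta> t T "(*) (1 / h (\<theta> t))"])
    show "(T has_derivative (*) (1 / h (\<theta> t))) (at (\<theta> t))"
      using dT by (simp add: has_field_derivative_def)
    show "(*) (1 / h (\<theta> t)) \<circ> (*) (h (\<theta> t)) = id"
      using h(1)[of "\<theta> t"] by (auto simp: fun_eq_iff)
  qed (auto simp: contT T\<theta> \<theta>T)
  moreover have "\<theta> 0 = \<theta>0" using \<theta>T[of \<theta>0] by (simp add: T_def)
  ultimately show ?thesis
    unfolding has_field_derivative_def by blast
qed

lemma norm_vec2_squared: "(norm (z :: real^2))\<^sup>2 = (z $ 1)\<^sup>2 + (z $ 2)\<^sup>2"
  unfolding power2_norm_eq_inner by (simp add: inner_vec_def sum_2 power2_eq_square)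

lemma vec2_polar: "\<exists>\<theta>. (z :: real^2) = norm z *\<^sub>R unit_circle \<theta>"
proof (cases "z = 0")
  case False
  then have "(z $ 1 / norm z)\<^sup>2 + (z $ 2 / norm z)\<^sup>2 = 1"
    by (simp add: power_divide flip: add_divide_distrib norm_vec2_squared)
  then obtain \<theta> where "z $ 1 / norm z = cos \<theta>" "z $ 2 / norm z = sin \<theta>"
    using sincos_total_2pi by metis
  then have "z $ 1 = norm z * cos \<theta>" "z $ 2 = norm z * sin \<theta>"
    using False by (simp_all add: field_simps)
  then show ?thesis by (intro exI[of _ \<theta>]) (simp add: vec_eq_iff forall_2)
qed simp

text \<open>Along a trajectory \<open>r\<close> is an explicit function \<open>R\<close> of \<open>\<theta>\<close>, and \<open>\<theta>\<close> solves the scalar equation \<open>\<theta>' = (R \<theta>)\<^sup>2\<close>.\<close>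

lemma cubic_field_solution_exists:
  assumes "a > 0"
  shows "\<exists>x. is_solution (cubic_field a b) {0..} x \<and> x 0 = z"
proof (cases "z = 0")
  case True
  then show ?thesis
    by (intro exI[of _ "\<lambda>_. 0"])
      (simp add: is_solution_def has_vector_derivative_vec2_iff cubic_field_nth)
next
  case False
  define \<rho> where "\<rho> = norm z"
  have "\<rho> > 0" using False by (simp add: \<rho>_def)
  obtain \<theta>0 where z: "z = \<rho> *\<^sub>R unit_circle \<theta>0" using vec2_polar unfolding \<rho>_def by blast
  \<comment> \<open>The solution of dR/d\<theta> = R (b cos 2\<theta> - a) with value \<rho> at
    \<theta>0, obtained by dividing the radial equation by the angular one.\<close>
  define R where "R u = \<rho> * exp (- a * (u - \<theta>0) + b / 2 * (sin (2 * u) - sin (2 * \<theta>0)))" for u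
  have dR: "(R has_real_derivative R u * (b * cos (2 * u) - a)) (at u)" for u
    unfolding R_def[abs_def] by (auto intro!: derivative_eq_intros simp: algebra_simps)
  have R_pos: "R u > 0" for u using \<open>\<rho> > 0\<close> by (simp add: R_def)
  have R_le: "R u \<le> \<rho> * exp \<bar>b\<bar>" if "u \<ge> \<theta>0" for u
  proof -
    have "\<bar>sin (2 * u) - sin (2 * \<theta>0)\<bar> \<le> 2"
      using abs_sin_le_one[of "2 * u"] abs_sin_le_one[of "2 * \<theta>0"] by linarith
    then have "\<bar>b / 2 * (sin (2 * u) - sin (2 * \<theta>0))\<bar> \<le> \<bar>b\<bar> / 2 * 2"
      unfolding abs_mult by (intro mult_mono) auto
    moreover have "a * (u - \<theta>0) \<ge> 0" using that \<open>a > 0\<close> by simp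
    ultimately show ?thesis using \<open>\<rho> > 0\<close> by (simp add: R_def)
  qed
  define h where "h u = (R (max u \<theta>0))\<^sup>2" for u
  have "\<exists>\<theta>. \<theta> 0 = \<theta>0 \<and> (\<forall>t. (\<theta> has_real_derivative h (\<theta> t)) (at t))"
  proof (rule autonomous_ode_exists)
    show "continuous_on UNIV h"
      unfolding h_def R_def by (intro continuous_intros)
    show "0 < h u" for u using R_pos[of "max u \<theta>0"] by (simp add: h_def)
    show "h u \<le> (\<rho> * exp \<bar>b\<bar>)\<^sup>2" for u
      unfolding h_def using R_le[of "max u \<theta>0"] R_pos[of "max u \<theta>0"] by (intro power_mono) auto
  qed
  then obtain \<theta> where \<theta>0: "\<theta> 0 = \<theta>0" and d\<theta>: "\<And>t. (\<theta> has_real_derivative h (\<theta> t)) (at t)"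
    by blast
  have \<theta>_ge: "\<theta> t \<ge> \<theta>0" if "t \<ge> 0" for t
  proof -
    have "\<theta> 0 \<le> \<theta> t"
      using that by (rule DERIV_nonneg_imp_nondecreasing) (use d\<theta> in \<open>force simp: h_def\<close>)
    then show ?thesis using \<theta>0 by simp
  qed
  define x where "x t = R (\<theta> t) *\<^sub>R unit_circle (\<theta> t)" for t
  have "(x has_vector_derivative cubic_field a b (x t)) (at t within {0..})" if "t \<ge> 0" for t
  proof -
    have d: "(\<theta> has_real_derivative (R (\<theta> t))\<^sup>2) (at t)"
      using d\<theta>[of t] \<theta>_ge[OF that] by (simp add: h_def max_def)
    have dR\<theta>: "((\<lambda>s. R (\<theta> s)) has_real_derivative
        R (\<theta> t) * (b * cos (2 * \<theta> t) - a) * (R (\<theta> t))\<^sup>2) (at t)"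
      using DERIV_chain2[OF dR d] .
    have n: "(R (\<theta> t) * cos (\<theta> t))\<^sup>2 + (R (\<theta> t) * sin (\<theta> t))\<^sup>2 = (R (\<theta> t))\<^sup>2"
      by (simp add: power_mult_distrib flip: distrib_left)
    have m: "(R (\<theta> t) * cos (\<theta> t))\<^sup>2 - (R (\<theta> t) * sin (\<theta> t))\<^sup>2 = (R (\<theta> t))\<^sup>2 * cos (2 * \<theta> t)"
      unfolding cos_double power_mult_distrib by (simp add: algebra_simps)
    have "((\<lambda>s. R (\<theta> s) * cos (\<theta> s)) has_real_derivative cubic_field a b (x t) $ 1) (at t)"
      by (rule derivative_eq_intros dR\<theta> d refl)+
        (simp add: cubic_field_nth x_def n m, simp add: algebra_simps)
    moreover have "((\<lambda>s. R (\<theta> s) * sin (\<theta> s)) has_real_derivative cubic_field a b (x t) $ 2) (at t)"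
      by (rule derivative_eq_intros dR\<theta> d refl)+
        (simp add: cubic_field_nth x_def n m, simp add: algebra_simps)
    ultimately show ?thesis
      unfolding has_vector_derivative_vec2_iff by (simp add: x_def has_field_derivative_at_within)
  qed
  moreover have "x 0 = z" by (simp add: x_def \<theta>0 z R_def)
  ultimately show ?thesis unfolding is_solution_def by auto
qed

section \<open>A nonpolynomial Lyapunov function and global asymptotic stability\<close>

definition lyapunov_fun :: "real \<Rightarrow> real^2 \<Rightarrow> real" where
  "lyapunov_fun b z = (norm z)\<^sup>2 * exp (- 2 * b * (z $ 1 * z $ 2) / (norm z)\<^sup>2)"

lemma lyapunov_fun_bounds:
  "lyapunov_fun b z \<le> exp \<bar>b\<bar> * (norm z)\<^sup>2" "(norm z)\<^sup>2 \<le> exp \<bar>b\<bar> * lyapunov_fun b z"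
proof -
  define e where "e = - 2 * b * (z $ 1 * z $ 2) / (norm z)\<^sup>2"
  have "2 * \<bar>z $ 1 * z $ 2\<bar> \<le> (norm z)\<^sup>2"
    using sum_squares_bound[of "\<bar>z $ 1\<bar>" "\<bar>z $ 2\<bar>"] by (simp add: norm_vec2_squared abs_mult mult.assoc)
  then have "\<bar>b\<bar> * (2 * \<bar>z $ 1 * z $ 2\<bar>) \<le> \<bar>b\<bar> * (norm z)\<^sup>2"
    by (rule mult_left_mono) simp
  then have e: "\<bar>e\<bar> \<le> \<bar>b\<bar>"
    by (cases "z = 0") (simp_all add: e_def abs_mult field_simps)
  have V: "lyapunov_fun b z = (norm z)\<^sup>2 * exp e" by (simp add: lyapunov_fun_def e_def)
  have "exp e \<le> exp \<bar>b\<bar>" using e by simp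
  then show "lyapunov_fun b z \<le> exp \<bar>b\<bar> * (norm z)\<^sup>2"
    unfolding V by (metis mult.commute mult_left_mono zero_le_power2)
  have "1 \<le> exp \<bar>b\<bar> * exp e" using e by (simp flip: exp_add)
  then have "(norm z)\<^sup>2 * 1 \<le> (norm z)\<^sup>2 * (exp \<bar>b\<bar> * exp e)"
    by (rule mult_left_mono) simp
  then show "(norm z)\<^sup>2 \<le> exp \<bar>b\<bar> * lyapunov_fun b z"
    unfolding V by (simp add: mult_ac)
qed

lemma lyapunov_fun_nonneg: "lyapunov_fun b z \<ge> 0"
  by (simp add: lyapunov_fun_def)

lemma lyapunov_fun_deriv:
  assumes x: "(x has_vector_derivative cubic_field a b (x t)) (at t within T)"
  shows "((\<lambda>s. lyapunov_fun b (x s)) has_real_derivative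
      - 2 * a * (norm (x t))\<^sup>2 * lyapunov_fun b (x t)) (at t within T)"
proof -
  define u v where "u s = x s $ 1" and "v s = x s $ 2" for s
  define n where "n s = (u s)\<^sup>2 + (v s)\<^sup>2" for s
  define p where "p s = u s * v s" for s
  have nx: "(norm (x s))\<^sup>2 = n s" for s
    by (simp add: norm_vec2_squared n_def u_def v_def)
  have V: "lyapunov_fun b (x s) = n s * exp (- 2 * b * (p s / n s))" for s
    by (simp add: lyapunov_fun_def nx p_def u_def v_def)
  define k where "k = b * ((u t)\<^sup>2 - (v t)\<^sup>2) - a * n t"
  have "cubic_field a b (x t) $ 1 = k * u t - n t * v t"
    "cubic_field a b (x t) $ 2 = k * v t + n t * u t"
    unfolding cubic_field_nth k_def n_def u_def v_def by (simp_all add: algebra_simps)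
  then have du: "(u has_real_derivative k * u t - n t * v t) (at t within T)"
    and dv: "(v has_real_derivative k * v t + n t * u t) (at t within T)"
    using x unfolding has_vector_derivative_vec2_iff u_def v_def by simp_all
  have dn: "(n has_real_derivative 2 * k * n t) (at t within T)"
    unfolding n_def[abs_def]
    by (rule derivative_eq_intros du dv refl)+ (simp add: n_def power2_eq_square algebra_simps)
  have dp: "(p has_real_derivative 2 * k * p t + n t * ((u t)\<^sup>2 - (v t)\<^sup>2)) (at t within T)"
    unfolding p_def[abs_def]
    by (rule derivative_eq_intros du dv refl)+ (simp add: power2_eq_square algebra_simps)
  show ?thesis
  proof (cases "n t = 0")
    case False
    have "((\<lambda>s. p s / n s) has_real_derivative (u t)\<^sup>2 - (v t)\<^sup>2) (at t within T)"
      by (rule derivative_eq_intros dp dn False refl)+ (use False in \<open>simp add: field_simps power2_eq_square\<close>)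
    then have "((\<lambda>s. n s * exp (- 2 * b * (p s / n s))) has_real_derivative
      2 * k * n t * exp (- 2 * b * (p t / n t))
       + exp (- 2 * b * (p t / n t)) * (- 2 * b * ((u t)\<^sup>2 - (v t)\<^sup>2)) * n t) (at t within T)"
      by (intro DERIV_mult dn DERIV_chain2[OF DERIV_exp] DERIV_cmult)
    moreover have "2 * k * n t * exp (- 2 * b * (p t / n t))
       + exp (- 2 * b * (p t / n t)) * (- 2 * b * ((u t)\<^sup>2 - (v t)\<^sup>2)) * n t
       = - 2 * a * n t * (n t * exp (- 2 * b * (p t / n t)))"
      unfolding k_def by (simp add: algebra_simps)
    ultimately show ?thesis unfolding V nx by metis
  next
    \<comment> \<open>At a passage through the origin the exponent need not be differentiable. The
      difference quotient of V is instead squeezed by exp |b| times that of \<open>n\<close>, which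
      tends to 0.\<close>
    case True
    have "((\<lambda>s. (n s - n t) / (s - t)) \<longlongrightarrow> 0) (at t within T)"
      using dn True by (simp add: has_field_derivative_iff)
    then have "((\<lambda>s. exp \<bar>b\<bar> * ((n s - n t) / (s - t))) \<longlongrightarrow> exp \<bar>b\<bar> * 0) (at t within T)"
      by (intro tendsto_intros)
    then have lim: "((\<lambda>s. \<bar>exp \<bar>b\<bar> * ((n s - n t) / (s - t))\<bar>) \<longlongrightarrow> 0) (at t within T)"
      by (intro tendsto_rabs_zero) simp
    have "norm ((lyapunov_fun b (x s) - lyapunov_fun b (x t)) / (s - t))
        \<le> \<bar>exp \<bar>b\<bar> * ((n s - n t) / (s - t))\<bar>" for s
    proof -
      have "\<bar>lyapunov_fun b (x s)\<bar> \<le> exp \<bar>b\<bar> * \<bar>n s\<bar>"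
        using lyapunov_fun_bounds(1)[of b "x s"] lyapunov_fun_nonneg[of b "x s"]
        by (simp add: nx n_def)
      then show ?thesis
        using True by (simp add: V[of t] abs_mult divide_right_mono)
    qed
    then have "((\<lambda>s. (lyapunov_fun b (x s) - lyapunov_fun b (x t)) / (s - t)) \<longlongrightarrow> 0) (at t within T)"
      by (intro Lim_null_comparison[OF _ lim] always_eventually allI)
    then show ?thesis
      using True by (simp add: has_field_derivative_iff nx)
  qed
qed

lemma cubic_field_globally_asymptotically_stable:
  assumes "a > 0"
  shows "globally_asymptotically_stable (cubic_field a b)"
  unfolding globally_asymptotically_stable_def
proof (intro conjI allI impI)
  let ?f = "cubic_field a b" and ?V = "lyapunov_fun b"
  have V_deriv: "((\<lambda>s. ?V (x s)) has_real_derivative - 2 * a * (norm (x t))\<^sup>2 * ?V (x t)) (at t within T)"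
    if "is_solution ?f T x" "t \<in> T" for T x t
    using that lyapunov_fun_deriv unfolding is_solution_def by blast
  show "lyapunov_stable ?f"
    unfolding lyapunov_stable_def
  proof (intro allI impI)
    fix \<epsilon> :: real assume "\<epsilon> > 0"
    have "norm (x t) < \<epsilon>"
      if x: "is_solution ?f {0..<\<tau>} x" and x0: "norm (x 0) < \<epsilon> / exp \<bar>b\<bar>" and t: "t \<in> {0..<\<tau>}" for \<tau> x t
    proof -
      have "?V (x t) - ?V (x 0) \<le> 0 * (t - 0)"
      proof (rule real_derivative_upper_bound[of 0 t "{0..<\<tau>}"])
        show "- 2 * a * (norm (x r))\<^sup>2 * ?V (x r) \<le> 0" for r
          using \<open>a > 0\<close> lyapunov_fun_nonneg[of b "x r"] by simp
      qed (use t V_deriv[OF x] in auto)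
      then have "?V (x t) \<le> ?V (x 0)" by simp
      then have "(norm (x t))\<^sup>2 \<le> exp \<bar>b\<bar> * ?V (x 0)"
        using lyapunov_fun_bounds(2)[of "x t" b] by (smt (verit) exp_ge_zero mult_left_mono)
      also have "\<dots> \<le> exp \<bar>b\<bar> * (exp \<bar>b\<bar> * (norm (x 0))\<^sup>2)"
        by (intro mult_left_mono lyapunov_fun_bounds) auto
      also have "\<dots> = (exp \<bar>b\<bar> * norm (x 0))\<^sup>2" by (simp add: power2_eq_square)
      finally have "norm (x t) \<le> exp \<bar>b\<bar> * norm (x 0)"
        by (rule power2_le_imp_le) simp
      also have "\<dots> < \<epsilon>" using x0 by (simp add: field_simps)
      finally show ?thesis .
    qed
    then show "\<exists>\<delta>>0. \<forall>\<tau> x. is_solution ?f {0..<\<tau>} x \<and> norm (x 0) < \<delta> \<longrightarrow>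
        (\<forall>t\<in>{0..<\<tau>}. norm (x t) < \<epsilon>)"
      using \<open>\<epsilon> > 0\<close> by (intro exI[of _ "\<epsilon> / exp \<bar>b\<bar>"]) auto
  qed
  show "forward_complete ?f"
    unfolding forward_complete_def
  proof (intro conjI allI impI)
    show "\<exists>x. is_solution ?f {0..} x \<and> x 0 = z" for z
      using cubic_field_solution_exists[OF assms] .
    fix \<tau> x assume x: "is_solution ?f {0..<\<tau>} x"
    \<comment> \<open>By uniqueness, the global solution with the same initial value extends
      \<open>x\<close>.\<close>
    obtain y where y: "is_solution ?f {0..} y" "y 0 = x 0"
      using cubic_field_solution_exists[OF assms] by blast
    have "is_solution ?f {0..<\<tau>} y"
      using y(1) by (rule is_solution_subset) auto
    then have "y t = x t" if "t \<in> {0..<\<tau>}" for t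
      using solution_unique[of ?f \<tau> y x t] cubic_field_lipschitz x y(2) that by blast
    then show "\<exists>y. is_solution ?f {0..} y \<and> (\<forall>t\<in>{0..<\<tau>}. y t = x t)"
      using y(1) by blast
  qed
  fix x assume x: "is_solution ?f {0..} x"
  have "((\<lambda>t. ?V (x t)) \<longlongrightarrow> 0) at_top"
  proof (rule tendsto_0_if_quadratic_decay)
    show "2 * a / exp \<bar>b\<bar> > 0" using \<open>a > 0\<close> by simp
    fix t :: real assume "t \<ge> 0"
    then show "((\<lambda>t. ?V (x t)) has_real_derivative - 2 * a * (norm (x t))\<^sup>2 * ?V (x t)) (at t within {0..})"
      using V_deriv[OF x] by simp
    have "?V (x t) * ?V (x t) \<le> exp \<bar>b\<bar> * (norm (x t))\<^sup>2 * ?V (x t)"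
      by (intro mult_right_mono lyapunov_fun_bounds lyapunov_fun_nonneg)
    then have "2 * a / exp \<bar>b\<bar> * (?V (x t))\<^sup>2 \<le> 2 * a / exp \<bar>b\<bar> * (exp \<bar>b\<bar> * (norm (x t))\<^sup>2 * ?V (x t))"
      unfolding power2_eq_square using \<open>a > 0\<close> by (intro mult_left_mono) auto
    then show "- 2 * a * (norm (x t))\<^sup>2 * ?V (x t) \<le> - (2 * a / exp \<bar>b\<bar>) * (?V (x t))\<^sup>2"
      by simp
  qed (rule lyapunov_fun_nonneg)
  then have "((\<lambda>t. exp \<bar>b\<bar> * ?V (x t)) \<longlongrightarrow> exp \<bar>b\<bar> * 0) at_top"
    by (intro tendsto_intros)
  then have "((\<lambda>t. (norm (x t))\<^sup>2) \<longlongrightarrow> 0) at_top"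
    by (intro Lim_null_comparison[of "\<lambda>t. (norm (x t))\<^sup>2"]) (auto simp: lyapunov_fun_bounds)
  then show "(x \<longlongrightarrow> 0) at_top"
    by (simp add: tendsto_norm_zero_iff)
qed

theorem mainTheorem2:
  fixes a b :: real
  assumes "a > 0" and "\<bar>b\<bar> \<ge> 2 * (a + 1)"
  shows "globally_asymptotically_stable (cubic_field a b) \<and>
         \<not> (\<exists>d P. homogeneous_polynomial d P \<and> positive_definite P \<and>
                (\<forall>z. lie_derivative (cubic_field a b) P z \<le> 0))"
  using cubic_field_globally_asymptotically_stable[OF assms(1)]
    no_polynomial_lyapunov_function[OF assms(2)] by blast

end
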